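(* Let $P(X)\in\mathbb{C}[X]$ be a polynomial of degree $n$, and let $u_i$ denote the roots of $P(X)$, $u_i$ having multiplicity $r_i$. There exist linear maps $L_i:{}^*\mathbb{C}[X]\to{}^*\mathbb{C}$, depending only on $P(X)$, such that for every ${}^*\mathbb{C}$-deformation $Q(X)$ of $P(X)$ and every root $\xi\in{}^*\mathbb{C}$ of $Q(X)$ with ${}^\circ\xi=u_i$ there is an infinitesimal $\varepsilon\in{}^*\mathbb{C}$ with $$(\xi-u_i)^{r_i}=L_i\big(Q(X)-P(X)\big)+\varepsilon\,\|(Q-P)(X)\|.$$
   Context: ${}^*\mathbb{R}$ denotes Robinson's field of hyperreal numbers (a non-archimedean ordered extension of $\mathbb{R}$ satisfying the transfer principle) and ${}^*\mathbb{C}={}^*\mathbb{R}+i\,{}^*\mathbb{R}$ the corresponding extension of $\mathbb{C}$. An element $z\in{}^*\mathbb{C}$ is finite if $|z|\in{}^*\mathbb{R}$ is bounded by an integer; it is infinitesimal if $|z|<r$ for every real $r>0$. $\mathcal{I}$ is the set of infinitesimals. For every finite $z\in{}^*\mathbb{C}$, ${}^\circ z$ denotes the unique element of $\mathbb{C}$ with $z-{}^\circ z\in\mathcal{I}$. A ${}^*\mathbb{C}$-deformation of a polynomial $P(X)\in\mathbb{C}[X]$ of degree $n$ is a polynomial $Q(X)\in{}^*\mathbb{C}[X]$ of degree $n$ such that all coefficients of $Q(X)-P(X)$ belong to $\mathcal{I}$. $\|\cdot\|$ is the canonical extension to the polynomials of degree at most $n$ over ${}^*\mathbb{C}$ of a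 fixed norm on the finite-dimensional space of polynomials of degree at most $n$ over $\mathbb{C}$ (for instance the maximum of the moduli of the coefficients). Linear means ${}^*\mathbb{C}$-linear. *)

theory Defs
  imports "HOL-Analysis.Analysis"
begin

section \<open>Index types carrying an ultrafilter\<close>

text \<open>
  The hyperreals are constructed as an ultrapower of the reals.  The index set and the ultrafilter
  are kept arbitrary: they come from a type of class \<open>ultra_index\<close>.  The last axiom of the class
  (countable incompleteness) says exactly that the ultrapower of the reals has infinite elements;
  for ultrafilters on \<^typ>\<open>nat\<close> it amounts to being free.
\<close>

class ultra_index =
  fixes ultra :: "'a filter"
  assumes ultra_proper: "ultra \<noteq> bot"
    and ultra_dichotomy: "eventually P ultra \<or> eventually (\<lambda>i. \<not> P i) ultra"
    and ultra_incomplete: "\<exists>f :: 'a \<Rightarrow> nat. filterlim f at_top ultra"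

lemma eventually_ultra_not_iff:
  "eventually (\<lambda>i. \<not> P i) ultra \<longleftrightarrow> \<not> eventually P (ultra :: 'i::ultra_index filter)"
  using ultra_dichotomy[of P] eventually_frequently[OF ultra_proper, of P]
  by (auto simp: frequently_def)

lemma frequently_ultra_iff:
  "frequently P ultra \<longleftrightarrow> eventually P (ultra :: 'i::ultra_index filter)"
  by (simp add: frequently_def eventually_ultra_not_iff)

lemma eventually_ultra_disj_iff:
  "eventually (\<lambda>i. P i \<or> Q i) ultra \<longleftrightarrow>
     eventually P ultra \<or> eventually Q (ultra :: 'i::ultra_index filter)"
  using frequently_disj_iff[of P Q ultra] by (simp add: frequently_ultra_iff)

lemma eventually_ultra_const_iff [simp]:
  "eventually (\<lambda>_. c) (ultra :: 'i::ultra_index filter) \<longleftrightarrow> c"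
  using ultra_proper by (cases c) (auto simp: trivial_limit_def)

lemma ex_free_ultrafilter_nat:
  "\<exists>U :: nat filter. U \<noteq> bot \<and> U \<le> sequentially \<and>
     (\<forall>P. eventually P U \<or> eventually (\<lambda>i. \<not> P i) U)"
proof -
  define A where "A = {F :: nat filter. F \<noteq> bot \<and> F \<le> sequentially}"
  have "\<exists>U\<in>A. \<forall>G\<in>A. G \<le> U \<longrightarrow> G = U"
  proof (rule predicate_Zorn)
    show "partial_order_on A (relation_of (\<lambda>F G. G \<le> F) A)"
      by (rule partial_order_on_relation_ofI) auto
  next
    fix C assume "C \<in> Chains (relation_of (\<lambda>F G. G \<le> F) A)"
    then have C: "C \<subseteq> A" and chain: "\<And>F G. F \<in> C \<Longrightarrow> G \<in> C \<Longrightarrow> F \<le> G \<or> G \<le> F"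
      by (auto simp: Chains_def relation_of_def)
    show "\<exists>U\<in>A. \<forall>F\<in>C. U \<le> F"
    proof (cases "C = {}")
      case True
      have "sequentially \<in> A" by (auto simp: A_def)
      with True show ?thesis by blast
    next
      case False
      then obtain F where F: "F \<in> C" by blast
      have "Inf C \<noteq> bot"
      proof
        assume "Inf C = bot"
        then have "eventually (\<lambda>_. False) (Inf C)" by simp
        then have "\<exists>G\<in>C. eventually (\<lambda>_. False) G"
          by (subst (asm) eventually_Inf_base) (use False chain in \<open>auto\<close>)
        with C show False by (auto simp: A_def trivial_limit_def)
      qed
      moreover have "Inf C \<le> sequentially"
        using C F by (auto simp: A_def intro!: Inf_lower2[of F])
      ultimately have "Inf C \<in> A" by (simp add: A_def)
      then show ?thesis by (auto intro: Inf_lower)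
    qed
  qed
  then obtain U where "U \<in> A" and U_min: "\<forall>G\<in>A. G \<le> U \<longrightarrow> G = U" ..
  then have U: "U \<noteq> bot" "U \<le> sequentially" by (auto simp: A_def)
  have max: "G = U" if "G \<noteq> bot" "G \<le> U" for G
  proof -
    from that U have "G \<in> A" by (auto simp: A_def intro: order_trans)
    with U_min that show ?thesis by blast
  qed
  have "eventually P U \<or> eventually (\<lambda>i. \<not> P i) U" for P
  proof (rule disjCI)
    assume "\<not> eventually (\<lambda>i. \<not> P i) U"
    then have "inf U (principal {i. P i}) \<noteq> bot"
      by (simp add: trivial_limit_def eventually_inf_principal)
    then have "inf U (principal {i. P i}) = U"
      by (rule max) simp
    moreover have "eventually P (inf U (principal {i. P i}))"
      by (simp add: eventually_inf_principal)
    ultimately show "eventually P U" by simp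
  qed
  with U show ?thesis by blast
qed

instantiation nat :: ultra_index
begin

definition ultra_nat :: "nat filter" where
  "ultra_nat = (SOME U. U \<noteq> bot \<and> U \<le> sequentially \<and>
     (\<forall>P. eventually P U \<or> eventually (\<lambda>i. \<not> P i) U))"

instance
proof -
  note * = someI_ex[OF ex_free_ultrafilter_nat, folded ultra_nat_def]
  have "filterlim (\<lambda>i. i) at_top (ultra :: nat filter)"
    using * by (simp add: filterlim_def filtermap_ident)
  then show "OFCLASS(nat, ultra_index_class)"
    by intro_classes (use * in auto)
qed

end


section \<open>Ultrapowers\<close>

quotient_type (overloaded) ('a, 'i) star =
  "'i::ultra_index \<Rightarrow> 'a" / "\<lambda>f g. eventually (\<lambda>i. f i = g i) ultra"
  morphisms star_rep star_abs
  by (rule equivpI) (auto intro!: reflpI sympI transpI elim: eventually_elim2 eventually_mono)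

lift_definition star_n :: "('i::ultra_index \<Rightarrow> 'a) \<Rightarrow> ('a, 'i) star" is "\<lambda>f. f" .

lift_definition star_of :: "'a \<Rightarrow> ('a, 'i::ultra_index) star" is "\<lambda>x _. x" .

lift_definition star_map :: "('a \<Rightarrow> 'b) \<Rightarrow> ('a, 'i::ultra_index) star \<Rightarrow> ('b, 'i) star"
  is "\<lambda>h f i. h (f i)"
  by (auto elim: eventually_mono)

lemma star_n_eq_iff: "star_n f = star_n g \<longleftrightarrow> eventually (\<lambda>i. f i = g i) ultra"
  by transfer simp

lemma star_n_surj: "\<exists>f. z = star_n f"
  by transfer (rule exI, rule always_eventually, rule allI, rule refl)

lemma star_of_eq_iff [simp]: "star_of x = star_of y \<longleftrightarrow> x = y"
  by transfer simp

lemma star_map_star_n: "star_map h (star_n f) = star_n (\<lambda>i. h (f i))"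
  by transfer simp

instantiation star :: (comm_ring_1, ultra_index) comm_ring_1
begin

lift_definition zero_star :: "('a, 'b) star" is "\<lambda>_. 0" .
lift_definition one_star :: "('a, 'b) star" is "\<lambda>_. 1" .
lift_definition plus_star :: "('a, 'b) star \<Rightarrow> ('a, 'b) star \<Rightarrow> ('a, 'b) star"
  is "\<lambda>f g i. f i + g i" by (auto elim: eventually_elim2)
lift_definition minus_star :: "('a, 'b) star \<Rightarrow> ('a, 'b) star \<Rightarrow> ('a, 'b) star"
  is "\<lambda>f g i. f i - g i" by (auto elim: eventually_elim2)
lift_definition uminus_star :: "('a, 'b) star \<Rightarrow> ('a, 'b) star"
  is "\<lambda>f i. - f i" by (auto elim: eventually_mono)
lift_definition times_star :: "('a, 'b) star \<Rightarrow> ('a, 'b) star \<Rightarrow> ('a, 'b) star"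
  is "\<lambda>f g i. f i * g i" by (auto elim: eventually_elim2)
instance
proof
  fix x y z :: "('a, 'b) star"
  show "x + y + z = x + (y + z)" by transfer (simp add: add.assoc)
  show "x + y = y + x" by transfer (simp add: add.commute)
  show "0 + x = x" by transfer simp
  show "- x + x = 0" by transfer simp
  show "x - y = x + - y" by transfer simp
  show "x * y * z = x * (y * z)" by transfer (simp add: mult.assoc)
  show "x * y = y * x" by transfer (simp add: mult.commute)
  show "1 * x = x" by transfer simp
  show "(x + y) * z = x * z + y * z" by transfer (simp add: distrib_right)
  show "(0 :: ('a, 'b) star) \<noteq> 1" by transfer simp
qed

end

instantiation star :: (inverse, ultra_index) inverse
begin

lift_definition inverse_star :: "('a, 'b) star \<Rightarrow> ('a, 'b) star"
  is "\<lambda>f i. inverse (f i)" by (auto elim: eventually_mono)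
lift_definition divide_star :: "('a, 'b) star \<Rightarrow> ('a, 'b) star \<Rightarrow> ('a, 'b) star"
  is "\<lambda>f g i. f i / g i" by (auto elim: eventually_elim2)

instance ..

end

instance star :: (field, ultra_index) field
proof
  fix x y :: "('a, 'b) star"
  show "x \<noteq> 0 \<Longrightarrow> inverse x * x = 1"
    by transfer (auto simp flip: eventually_ultra_not_iff elim: eventually_mono)
  show "x / y = x * inverse y" by transfer (simp add: divide_inverse)
  show "inverse (0 :: ('a, 'b) star) = 0" by transfer simp
qed

instantiation star :: (linordered_field, ultra_index) linordered_field
begin

lift_definition less_eq_star :: "('a, 'b) star \<Rightarrow> ('a, 'b) star \<Rightarrow> bool"
  is "\<lambda>f g. eventually (\<lambda>i. f i \<le> g i) ultra"
  by (rule iffI; elim eventually_rev_mp) (auto elim!: eventually_elim2)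
lift_definition less_star :: "('a, 'b) star \<Rightarrow> ('a, 'b) star \<Rightarrow> bool"
  is "\<lambda>f g. eventually (\<lambda>i. f i < g i) ultra"
  by (rule iffI; elim eventually_rev_mp) (auto elim!: eventually_elim2)
lift_definition abs_star :: "('a, 'b) star \<Rightarrow> ('a, 'b) star"
  is "\<lambda>f i. \<bar>f i\<bar>" by (auto elim: eventually_mono)
lift_definition sgn_star :: "('a, 'b) star \<Rightarrow> ('a, 'b) star"
  is "\<lambda>f i. sgn (f i)" by (auto elim: eventually_mono)

instance
proof
  fix x y z :: "('a, 'b) star"
  show "x < y \<longleftrightarrow> x \<le> y \<and> \<not> y \<le> x"
    by transfer (auto simp: less_le_not_le eventually_conj_iff simp flip: eventually_ultra_not_iff)
  show "x \<le> x" by transfer simp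
  show "x \<le> y \<Longrightarrow> y \<le> z \<Longrightarrow> x \<le> z"
    by transfer (auto elim: eventually_elim2)
  show "x \<le> y \<Longrightarrow> y \<le> x \<Longrightarrow> x = y"
    by transfer (auto elim: eventually_elim2)
  show "x \<le> y \<or> y \<le> x"
    by transfer (auto simp flip: eventually_ultra_disj_iff intro: always_eventually)
  show "x \<le> y \<Longrightarrow> z + x \<le> z + y" by transfer simp
  show "x < y \<Longrightarrow> 0 < z \<Longrightarrow> z * x < z * y"
    by transfer (auto elim: eventually_elim2)
  show "\<bar>x\<bar> = (if x < 0 then - x else x)"
  proof (cases "x < 0")
    case True
    then have "\<bar>x\<bar> = - x" by transfer (auto elim: eventually_mono)
    with True show ?thesis by simp
  next
    case False
    then have "\<bar>x\<bar> = x"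
      by transfer (auto simp flip: eventually_ultra_not_iff elim: eventually_mono)
    with False show ?thesis by simp
  qed
  show "sgn x = (if x = 0 then 0 else if 0 < x then 1 else - 1)"
  proof -
    have "x = 0 \<Longrightarrow> sgn x = 0" by transfer (auto elim: eventually_mono)
    moreover have "0 < x \<Longrightarrow> sgn x = 1" by transfer (auto elim: eventually_mono)
    moreover have "sgn x = - 1" if "x \<noteq> 0" "\<not> 0 < x"
      using that
      by transfer (auto simp flip: eventually_ultra_not_iff simp: sgn_if elim: eventually_elim2)
    ultimately show ?thesis by auto
  qed
qed

end

lemma star_of_hom [simp]:
  "star_of 0 = 0" "star_of 1 = 1" "star_of (x + y) = star_of x + star_of y"
  "star_of (x - y) = star_of x - star_of y" "star_of (- x) = - star_of x"
  "star_of (x * y) = star_of x * star_of y"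
  by (transfer; simp)+

lemma star_of_inverse_hom [simp]:
  "star_of (inverse x) = inverse (star_of x)"
  "star_of (x / y) = star_of x / star_of y"
  by (transfer; simp)+

lemma star_of_le_iff [simp]: "star_of x \<le> star_of y \<longleftrightarrow> x \<le> y"
  by transfer simp

lemma star_of_less_iff [simp]: "star_of x < star_of y \<longleftrightarrow> x < y"
  by transfer simp

lemma of_nat_star:
  "of_nat n = (star_of (of_nat n) :: ('a::comm_ring_1, 'i::ultra_index) star)"
  by (induction n) simp_all


section \<open>Hyperreal and hypercomplex numbers\<close>

type_synonym 'i hyperreal = "(real, 'i) star"
type_synonym 'i hypercomplex = "(complex, 'i) star"

definition hypercomplex_of :: "'i::ultra_index hyperreal \<Rightarrow> 'i hypercomplex" where
  "hypercomplex_of = star_map of_real"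

definition hcmod :: "'i::ultra_index hypercomplex \<Rightarrow> 'i hyperreal" where
  "hcmod = star_map cmod"

lemma hyperreal_nonarchimedean: "\<exists>x :: 'i::ultra_index hyperreal. \<forall>n. of_nat n < x"
proof -
  obtain f :: "'i \<Rightarrow> nat" where f: "filterlim f at_top ultra"
    using ultra_incomplete by blast
  have "of_nat n < star_n (\<lambda>i. real (f i))" for n
  proof -
    have "eventually (\<lambda>i. Suc n \<le> f i) ultra"
      using f unfolding filterlim_at_top by blast
    then show ?thesis
      unfolding of_nat_star by transfer (auto elim!: eventually_mono)
  qed
  then show ?thesis by blast
qed

lemma hypercomplex_decomp:
  "z = hypercomplex_of (star_map Re z) + star_of \<i> * hypercomplex_of (star_map Im z)"
  unfolding hypercomplex_of_def by transfer (simp add: complex_eq)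

lemma hypercomplex_decomp_unique:
  "hypercomplex_of a + star_of \<i> * hypercomplex_of b =
     hypercomplex_of c + star_of \<i> * hypercomplex_of d \<longleftrightarrow> a = c \<and> b = d"
  unfolding hypercomplex_of_def
  by transfer (simp add: complex_eq_iff eventually_conj_iff)

lemma hcmod_nonneg: "0 \<le> hcmod z"
  unfolding hcmod_def by transfer simp

lemma hcmod_square: "hcmod z ^ 2 = star_map Re z ^ 2 + star_map Im z ^ 2"
  unfolding hcmod_def power2_eq_square
  by transfer (simp add: cmod_power2 flip: power2_eq_square)

definition hfinite :: "'i::ultra_index hypercomplex \<Rightarrow> bool" where
  "hfinite z \<longleftrightarrow> (\<exists>n :: nat. hcmod z \<le> of_nat n)"

definition infinitesimal :: "'i::ultra_index hypercomplex \<Rightarrow> bool" where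
  "infinitesimal z \<longleftrightarrow> (\<forall>r > 0. hcmod z < star_of r)"

text \<open>Only meaningful for finite arguments.\<close>

definition std_part :: "'i::ultra_index hypercomplex \<Rightarrow> complex" where
  "std_part z = (THE w. infinitesimal (z - star_of w))"

lemma std_part_ex1:
  fixes z :: "'i::ultra_index hypercomplex"
  assumes "hfinite z"
  shows "\<exists>!w. infinitesimal (z - star_of w)"
proof -
  obtain f where z: "z = star_n f" using star_n_surj by blast
  have inf_iff: "infinitesimal (z - star_of w) \<longleftrightarrow> (f \<longlongrightarrow> w) ultra" for w
  proof -
    have "hcmod (z - star_of w) < star_of r \<longleftrightarrow> eventually (\<lambda>i. dist (f i) w < r) ultra" for r
      unfolding z hcmod_def by transfer (simp add: dist_norm)
    then show ?thesis by (simp add: infinitesimal_def tendsto_iff)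
  qed
  obtain n where n: "hcmod z \<le> of_nat n" using assms by (auto simp: hfinite_def)
  have bd: "eventually (\<lambda>w. w \<in> cball 0 (real n)) (filtermap f ultra)"
    using n unfolding z hcmod_def of_nat_star eventually_filtermap by transfer simp
  have "filtermap f ultra \<noteq> bot" by (simp add: filtermap_bot_iff ultra_proper)
  with bd obtain w where w: "inf (nhds w) (filtermap f ultra) \<noteq> bot"
    using compact_cball[of "0::complex" "real n"] unfolding compact_filter by blast
  have "(f \<longlongrightarrow> w) ultra"
  proof (rule tendstoI, rule ccontr)
    fix e :: real assume e: "e > 0" and "\<not> eventually (\<lambda>i. dist (f i) w < e) ultra"
    then have "eventually (\<lambda>v. \<not> dist v w < e) (filtermap f ultra)"
      unfolding eventually_filtermap eventually_ultra_not_iff by simp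
    moreover have "eventually (\<lambda>v. dist v w < e) (nhds w)"
      using e by (auto simp: eventually_nhds_metric)
    ultimately have "eventually (\<lambda>_. False) (inf (nhds w) (filtermap f ultra))"
      unfolding eventually_inf by blast
    with w show False by (simp add: trivial_limit_def)
  qed
  then show ?thesis
    unfolding inf_iff using tendsto_unique[OF ultra_proper] by blast
qed


section \<open>Polynomials\<close>

definition is_deformation :: "complex poly \<Rightarrow> 'i::ultra_index hypercomplex poly \<Rightarrow> bool" where
  "is_deformation P Q \<longleftrightarrow>
     degree Q = degree P \<and> (\<forall>k. infinitesimal (coeff (Q - map_poly star_of P) k))"

definition is_poly_norm :: "nat \<Rightarrow> (complex poly \<Rightarrow> real) \<Rightarrow> bool" where
  "is_poly_norm n N \<longleftrightarrow>
     (\<forall>p. degree p \<le> n \<longrightarrow> 0 \<le> N p \<and> (N p = 0 \<longleftrightarrow> p = 0)) \<and>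
     (\<forall>c p. degree p \<le> n \<longrightarrow> N (smult c p) = cmod c * N p) \<and>
     (\<forall>p q. degree p \<le> n \<longrightarrow> degree q \<le> n \<longrightarrow> N (p + q) \<le> N p + N q)"

text \<open>
  The canonical extension of a function \<open>N\<close> on complex polynomials: choose a representing sequence
  for each coefficient, apply \<open>N\<close> to the resulting sequence of complex polynomials, and take the
  class of the values.  Lemma \<open>star_poly_norm_eq\<close> shows that the choice is irrelevant.
\<close>

definition star_seq :: "('a, 'i::ultra_index) star \<Rightarrow> 'i \<Rightarrow> 'a" where
  "star_seq z = (SOME f. z = star_n f)"

lemma star_n_star_seq: "star_n (star_seq z) = z"
  unfolding star_seq_def using someI_ex[OF star_n_surj[of z]] by simp

definition star_poly_norm ::
    "(complex poly \<Rightarrow> real) \<Rightarrow> 'i::ultra_index hypercomplex poly \<Rightarrow> 'i hyperreal" where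
  "star_poly_norm N Q = star_n (\<lambda>i. N (map_poly (\<lambda>z. star_seq z i) Q))"

lemma star_poly_norm_eq:
  assumes deg: "\<And>i. degree (p i) \<le> n"
    and coeff: "\<And>k. coeff Q k = star_n (\<lambda>i. coeff (p i) k)"
  shows "star_poly_norm N Q = star_n (\<lambda>i. N (p i))"
proof -
  have zero: "star_n (\<lambda>_. 0) = (0 :: 'i::ultra_index hypercomplex)"
    by transfer simp
  have Qn: "degree Q \<le> n"
  proof (rule degree_le, intro allI impI)
    fix k assume "n < k"
    then have "coeff (p i) k = 0" for i
      using deg[of i] by (intro coeff_eq_0) simp
    then show "coeff Q k = 0" using coeff[of k] zero by simp
  qed
  have cf: "coeff (map_poly (\<lambda>z. star_seq z i) Q) k =
      (if k < length (coeffs Q) then star_seq (coeff Q k) i else 0)" for i k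
    by (auto simp: map_poly_def coeff_Poly_eq nth_default_def simp flip: nth_default_coeffs_eq)
  have len: "coeff Q k = 0" if "\<not> k < length (coeffs Q)" for k
    using that by (simp add: nth_default_def flip: nth_default_coeffs_eq)
  have "eventually (\<lambda>i. \<forall>k\<in>{..n}. coeff (map_poly (\<lambda>z. star_seq z i) Q) k = coeff (p i) k) ultra"
  proof (intro eventually_ball_finite ballI)
    fix k
    show "eventually (\<lambda>i. coeff (map_poly (\<lambda>z. star_seq z i) Q) k = coeff (p i) k) ultra"
    proof (cases "k < length (coeffs Q)")
      case True
      with coeff[of k] show ?thesis by (simp add: cf star_n_eq_iff[symmetric] star_n_star_seq)
    next
      case False
      then have "star_n (\<lambda>i. coeff (p i) k) = star_n (\<lambda>_. 0)"
        using coeff[of k] len[of k] by (simp add: zero)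
      then have "eventually (\<lambda>i. coeff (p i) k = 0) ultra" by (simp add: star_n_eq_iff)
      with False show ?thesis by (auto simp: cf elim: eventually_mono)
    qed
  qed simp
  then have "eventually (\<lambda>i. map_poly (\<lambda>z. star_seq z i) Q = p i) ultra"
  proof eventually_elim
    case (elim i)
    have "coeff (map_poly (\<lambda>z. star_seq z i) Q) k = coeff (p i) k" for k
    proof (cases "k \<le> n")
      case False
      then show ?thesis
        using Qn deg[of i] by (cases "Q = 0") (auto simp: cf coeff_eq_0 length_coeffs_degree)
    qed (use elim in auto)
    then show ?case by (rule poly_eqI)
  qed
  then show ?thesis
    unfolding star_poly_norm_def star_n_eq_iff by (auto elim: eventually_mono)
qed

end

theory Submission
  imports Defs
begin

text \<open>
  Write \<open>P = (X - u)\<^sup>r S\<close> with \<open>S(u) \<noteq> 0\<close> and \<open>R = Q - P\<close>.  A root \<open>\<xi>\<close> of \<open>Q\<close> satisfies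
  \<open>(\<xi> - u)\<^sup>r = - R(\<xi>) / S(\<xi>)\<close>, which suggests \<open>L(R) = - R(u) / S(u)\<close>.  The error is a combination of
  the infinitesimals \<open>u\<^sup>k / S(u) - \<xi>\<^sup>k / S(\<xi>)\<close> with the coefficients of \<open>R\<close>, and these
  are finite multiples of \<open>\<parallel>R\<parallel>\<close> because all norms on a finite-dimensional space are equivalent.
\<close>

section \<open>Norms on polynomials of bounded degree\<close>

lemma degree_sum_monom_le: "degree (\<Sum>k\<le>n. monom (f k) k) \<le> n"
  by (intro degree_sum_le) (auto intro: order_trans[OF degree_monom_le])

lemma coeff_sum_monom:
  "coeff (\<Sum>k\<le>n. monom (f k) k) j = (if j \<le> n then f j else 0)"
  by (simp add: coeff_sum)

text \<open>Triangle inequality and homogeneity, one monomial at a time. The separate bound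
  \<open>m\<close> serves the induction: \<open>N\<close> is controlled only up to degree
  \<open>n\<close>, which must stay fixed while the sum grows.\<close>

lemma is_poly_norm_sum_monom_le:
  assumes N: "is_poly_norm n N" and "m \<le> n"
  shows "N (\<Sum>k\<le>m. monom (f k) k) \<le> (\<Sum>k\<le>m. cmod (f k) * N (monom 1 k))"
proof -
  have monom: "N (monom (f k) k) = cmod (f k) * N (monom 1 k)" if "k \<le> n" for k
  proof -
    have "N (smult (f k) (monom 1 k)) = cmod (f k) * N (monom 1 k)"
      using N that by (simp add: is_poly_norm_def degree_monom_eq)
    then show ?thesis by (simp add: smult_monom)
  qed
  show ?thesis using \<open>m \<le> n\<close>
  proof (induction m)
    case 0
    then show ?case using monom[of 0] by simp
  next
    case (Suc m)
    have "degree (monom (f (Suc m)) (Suc m)) \<le> n"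
      using Suc.prems degree_monom_le order_trans by blast
    moreover have "degree (\<Sum>k\<le>m. monom (f k) k) \<le> n"
      using degree_sum_monom_le[of f m] Suc.prems by linarith
    ultimately have "N ((\<Sum>k\<le>m. monom (f k) k) + monom (f (Suc m)) (Suc m)) \<le>
        N (\<Sum>k\<le>m. monom (f k) k) + N (monom (f (Suc m)) (Suc m))"
      using N by (simp add: is_poly_norm_def)
    with Suc monom[of "Suc m"] show ?case by simp
  qed
qed

lemma is_poly_norm_diff_le:
  assumes N: "is_poly_norm n N" and p: "degree p \<le> n" and q: "degree q \<le> n"
  shows "\<bar>N p - N q\<bar> \<le> N (p - q)"
proof -
  have d: "degree (p - q) \<le> n" "degree (q - p) \<le> n"
    using p q by (auto intro: degree_diff_le)
  have "N (smult (-1) (p - q)) = cmod (-1) * N (p - q)"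
    using N d unfolding is_poly_norm_def by blast
  then have "N (q - p) = N (p - q)" by simp
  moreover have "N (q + (p - q)) \<le> N q + N (p - q)" "N (p + (q - p)) \<le> N p + N (q - p)"
    using N p q d unfolding is_poly_norm_def by blast+
  ultimately show ?thesis by simp
qed

text \<open>Polynomials are parametrized by coefficient functions on \<open>nat\<close> with the
  product topology, so that compactness can come from Tychonoff. Continuity holds because the
  increment of \<open>N\<close> is dominated by a finite weighted sum of coordinate
  increments.\<close>

lemma continuous_on_poly_norm:
  assumes N: "is_poly_norm n N"
  shows "continuous_on A (\<lambda>f. N (\<Sum>k\<le>n. monom (f k) k))"
  unfolding continuous_on_def
proof
  fix f assume "f \<in> A"
  have coord: "((\<lambda>g. g k) \<longlongrightarrow> f k) (at f within A)" for k
    using continuous_on_product_coordinates[of k] unfolding continuous_on_def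
    by (blast intro: tendsto_within_subset)
  have "((\<lambda>g. \<Sum>k\<le>n. cmod (g k - f k) * N (monom 1 k)) \<longlongrightarrow>
      (\<Sum>k\<le>n. cmod (f k - f k) * N (monom 1 k))) (at f within A)"
    by (intro tendsto_intros coord)
  then have lim: "((\<lambda>g. \<Sum>k\<le>n. cmod (g k - f k) * N (monom 1 k)) \<longlongrightarrow> 0) (at f within A)"
    by simp
  have "\<bar>N (\<Sum>k\<le>n. monom (g k) k) - N (\<Sum>k\<le>n. monom (f k) k)\<bar> \<le>
      (\<Sum>k\<le>n. cmod (g k - f k) * N (monom 1 k))" for g
  proof -
    have "(\<Sum>k\<le>n. monom (g k) k) - (\<Sum>k\<le>n. monom (f k) k) = (\<Sum>k\<le>n. monom (g k - f k) k)"
      by (simp add: sum_subtractf flip: diff_monom)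
    then show ?thesis
      using is_poly_norm_diff_le[OF N degree_sum_monom_le degree_sum_monom_le, of g f]
        is_poly_norm_sum_monom_le[OF N order_refl, of "\<lambda>k. g k - f k"] by simp
  qed
  then have "((\<lambda>g. N (\<Sum>k\<le>n. monom (g k) k) - N (\<Sum>k\<le>n. monom (f k) k)) \<longlongrightarrow> 0) (at f within A)"
    by (intro Lim_null_comparison[OF _ lim]) simp
  then show "((\<lambda>g. N (\<Sum>k\<le>n. monom (g k) k)) \<longlongrightarrow> N (\<Sum>k\<le>n. monom (f k) k)) (at f within A)"
    by (rule LIM_zero_cancel)
qed

text \<open>One half of the equivalence of norms: \<open>N\<close> has a positive minimum on the
  compact sphere of coefficient vectors of maximum modulus 1, and scaling extends the bound to all
  polynomials.\<close>

lemma coeff_le_poly_norm: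
  assumes N: "is_poly_norm n N"
  obtains C where "\<And>p k. degree p \<le> n \<Longrightarrow> cmod (coeff p k) \<le> C * N p"
proof -
  define q :: "(nat \<Rightarrow> complex) \<Rightarrow> complex poly" where "q f = (\<Sum>k\<le>n. monom (f k) k)" for f
  \<comment> \<open>Coordinates beyond \<open>n\<close> are pinned to 0, so \<open>B\<close> is a
    product of compact sets and \<open>S\<close> below is the unit sphere of the maximum
    norm.\<close>
  define B :: "(nat \<Rightarrow> complex) set"
    where "B = (\<Pi>\<^sub>E k\<in>UNIV. if k \<le> n then cball 0 1 else {0})"
  define S where "S = B \<inter> (\<Union>k\<le>n. {f. cmod (f k) = 1})"
  have "compact B"
  proof -
    have "compactin (product_topology (\<lambda>_. euclidean) UNIV) B"
      unfolding B_def by (subst compactin_PiE) auto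
    then show ?thesis by (simp add: euclidean_product_topology)
  qed
  moreover have "closed {f :: nat \<Rightarrow> complex. cmod (f k) = 1}" for k
    by (intro closed_Collect_eq continuous_intros continuous_on_product_coordinates)
  ultimately have "compact S"
    unfolding S_def by (intro compact_Int_closed closed_UN) auto
  \<comment> \<open>The constant polynomial 1 shows that the sphere is nonempty, so the minimum is
    attained.\<close>
  moreover have "(\<lambda>k. if k = 0 then 1 else 0) \<in> S"
    by (auto simp: S_def B_def)
  ultimately obtain f where f: "f \<in> S" and f_min: "\<And>g. g \<in> S \<Longrightarrow> N (q f) \<le> N (q g)"
    using continuous_attains_inf[OF _ _ continuous_on_poly_norm[OF N], of S]
    unfolding q_def by blast
  have "q f \<noteq> 0"
  proof
    assume "q f = 0"
    then have "coeff (q f) k = 0" for k by simp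
    then have "f k = 0" if "k \<le> n" for k using that unfolding q_def coeff_sum_monom by metis
    with f show False by (auto simp: S_def)
  qed
  moreover have "degree (q f) \<le> n" unfolding q_def by (rule degree_sum_monom_le)
  ultimately have pos: "N (q f) > 0"
    using N by (auto simp: is_poly_norm_def less_le)
  have "cmod (coeff p k) \<le> (1 / N (q f)) * N p" if p: "degree p \<le> n" for p k
  proof (cases "coeff p k = 0")
    case True
    then show ?thesis using N p pos by (simp add: is_poly_norm_def)
  next
    case False
    then have k: "k \<le> n" using p by (meson coeff_eq_0 leI order_le_less_trans)
    \<comment> \<open>Division by the largest modulus \<open>M\<close> moves \<open>p\<close> onto
      the sphere.\<close>
    define M where "M = Max ((\<lambda>k. cmod (coeff p k)) ` {..n})"
    have M: "cmod (coeff p j) \<le> M" if "j \<le> n" for j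
      unfolding M_def using that by (intro Max_ge) auto
    have M_pos: "M > 0" using M[OF k] False by (smt (verit) zero_less_norm_iff)
    have "M \<in> (\<lambda>k. cmod (coeff p k)) ` {..n}"
      unfolding M_def by (intro Max_in) auto
    then obtain j where j: "j \<le> n" "cmod (coeff p j) = M" by auto
    define g where "g i = coeff p i / of_real M" for i
    have "g \<in> B"
      using M M_pos p by (auto simp: B_def g_def norm_divide coeff_eq_0)
    moreover have "cmod (g j) = 1" using j M_pos by (simp add: g_def norm_divide)
    ultimately have "g \<in> S" using j by (auto simp: S_def)
    moreover have "q g = smult (inverse (of_real M)) p"
      using p by (intro poly_eqI)
        (auto simp: q_def coeff_sum_monom g_def field_simps coeff_eq_0)
    moreover have "N (smult (inverse (of_real M)) p) = cmod (inverse (of_real M)) * N p"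
      using N p by (simp add: is_poly_norm_def)
    ultimately have "N (q f) \<le> N p / M"
      using f_min[of g] M_pos by (simp add: norm_inverse divide_inverse mult.commute)
    then have "M \<le> 1 / N (q f) * N p"
      using M_pos pos by (simp add: pos_le_divide_eq mult.commute)
    with M[OF k] show ?thesis by (rule order_trans)
  qed
  then show thesis by (rule that)
qed


section \<open>Infinitesimals as null sequences along the ultrafilter\<close>

lemma infinitesimal_star_n_iff: "infinitesimal (star_n f) \<longleftrightarrow> (f \<longlongrightarrow> 0) ultra"
proof -
  have "hcmod (star_n f) < star_of r \<longleftrightarrow> eventually (\<lambda>i. dist (f i) 0 < r) ultra" for r
    unfolding hcmod_def by transfer simp
  then show ?thesis by (simp add: infinitesimal_def tendsto_iff)
qed

lemma star_n_arith:
  "star_n f + star_n g = star_n (\<lambda>i. f i + g i)"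
  "star_n f * star_n g = star_n (\<lambda>i. f i * g i)"
  "star_n f - star_n g = star_n (\<lambda>i. f i - g i)"
  by (transfer; simp)+

lemma infinitesimal_0: "infinitesimal 0"
proof -
  have "infinitesimal (star_n (\<lambda>_. 0))" unfolding infinitesimal_star_n_iff by simp
  then show ?thesis by (simp add: zero_star.abs_eq star_n.abs_eq)
qed

lemma infinitesimal_add:
  assumes "infinitesimal x" "infinitesimal y"
  shows "infinitesimal (x + y)"
proof -
  obtain f g where "x = star_n f" "y = star_n g" using star_n_surj by metis
  with assms show ?thesis
    using tendsto_add[of f 0 ultra g 0] by (simp add: star_n_arith infinitesimal_star_n_iff)
qed

lemma infinitesimal_sum:
  "(\<And>k. k \<in> A \<Longrightarrow> infinitesimal (f k)) \<Longrightarrow> infinitesimal (sum f A)"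
  by (induction A rule: infinite_finite_induct) (auto intro: infinitesimal_0 infinitesimal_add)

text \<open>A standard bound on \<open>x\<close> makes its representative bounded along
  \<open>ultra\<close>, and bounded times null is null.\<close>

lemma infinitesimal_mult_bounded:
  assumes "hcmod x \<le> star_of C" "infinitesimal y"
  shows "infinitesimal (x * y)"
proof -
  obtain f g where fg: "x = star_n f" "y = star_n g" using star_n_surj by metis
  have "eventually (\<lambda>i. norm (f i) \<le> C) ultra"
    using assms(1) unfolding fg hcmod_def by transfer
  then have "Bfun f ultra" by (rule BfunI)
  moreover have "Zfun g ultra"
    using assms(2) by (simp add: fg infinitesimal_star_n_iff tendsto_Zfun_iff)
  ultimately have "Zfun (\<lambda>i. f i * g i) ultra"
    by (rule bounded_bilinear.Bfun_prod_Zfun[OF bounded_bilinear_mult])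
  then show ?thesis by (simp add: fg star_n_arith infinitesimal_star_n_iff tendsto_Zfun_iff)
qed

text \<open>The nonstandard form of continuity: limits along \<open>ultra\<close> pass through
  \<open>h\<close>.\<close>

lemma infinitesimal_star_map_isCont:
  assumes "isCont h u" "infinitesimal (\<xi> - star_of u)"
  shows "infinitesimal (star_map h \<xi> - star_of (h u))"
proof -
  obtain f where f: "\<xi> = star_n f" using star_n_surj by blast
  have const: "star_of v = star_n (\<lambda>_. v)" for v :: complex by transfer simp
  have "(f \<longlongrightarrow> u) ultra"
    using assms(2) by (simp add: f const star_n_arith infinitesimal_star_n_iff LIM_zero_iff)
  then have "((\<lambda>i. h (f i)) \<longlongrightarrow> h u) ultra" by (rule isCont_tendsto_compose[OF assms(1)])
  then show ?thesis
    by (simp add: f const star_map_star_n star_n_arith infinitesimal_star_n_iff LIM_zero_iff)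
qed

lemma infinitesimal_std_part:
  "hfinite z \<Longrightarrow> infinitesimal (z - star_of (std_part z))"
  unfolding std_part_def by (rule theI', rule std_part_ex1)

text \<open>A constant family has only one limit. This later separates \<open>s\<close> from
  0.\<close>

lemma infinitesimal_star_of_iff: "infinitesimal (star_of c :: 'i::ultra_index hypercomplex) \<longleftrightarrow> c = 0"
proof -
  have "star_of c = (star_n (\<lambda>_. c) :: 'i hypercomplex)" by transfer simp
  then show ?thesis by (simp add: infinitesimal_star_n_iff tendsto_const_iff[OF ultra_proper])
qed


section \<open>Polynomials over the hypercomplex numbers\<close>

text \<open>The primed names in the last clause keep the sort needed for division away from the ring
  clauses.\<close>

lemma star_map_hom:
  "star_map (\<lambda>x. f x + g x) z = star_map f z + star_map g z"
  "star_map (\<lambda>x. f x - g x) z = star_map f z - star_map g z"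
  "star_map (\<lambda>x. f x * g x) z = star_map f z * star_map g z"
  "star_map (\<lambda>x. f' x / g' x) z = star_map f' z / star_map g' z"
  by (transfer; simp)+

lemma star_map_const_ident: "star_map (\<lambda>_. c) z = star_of c" "star_map (\<lambda>x. x) z = z"
  by (transfer; simp)+

lemma star_map_power: "star_map (\<lambda>x. x ^ k) z = (z ^ k :: ('a::comm_ring_1, 'i::ultra_index) star)"
  by (induction k) (simp_all add: star_map_const_ident star_map_hom)

lemma star_of_power: "star_of (x ^ k) = (star_of x ^ k :: ('a::comm_ring_1, 'i::ultra_index) star)"
  by (induction k) simp_all

text \<open>Reduces evaluation of a standard polynomial at a hypercomplex point to
  \<open>star_map\<close>, where identities between standard functions apply.\<close>

lemma poly_map_poly_star_of:
  "poly (map_poly star_of p) z = star_map (poly p) (z :: ('a::comm_ring_1, 'i::ultra_index) star)"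
proof (induction p)
  case 0
  then show ?case by (simp, transfer, simp)
next
  case (pCons a p)
  have "star_map (\<lambda>x. a + x * poly p x) z = star_of a + z * star_map (poly p) z"
    by (simp add: star_map_hom star_map_const_ident)
  with pCons show ?case by (simp add: map_poly_pCons)
qed

lemma poly_eq_sum_coeff:
  "degree p \<le> n \<Longrightarrow> poly p x = (\<Sum>k\<le>n. coeff p k * x ^ k)"
  for x :: "'a::comm_ring_1"
  by (subst poly_as_sum_of_monoms'[symmetric]) (auto simp: poly_sum poly_monom)

text \<open>The standard coefficient bound is applied at every index of a representative. The
  product form lets the norm be factored out of the error term.\<close>

lemma coeff_star_poly_norm:
  fixes R :: "'i::ultra_index hypercomplex poly"
  assumes N: "is_poly_norm n N" and R: "degree R \<le> n"
  obtains b C where "\<And>k. coeff R k = b k * hypercomplex_of (star_poly_norm N R)"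
    and "\<And>k. hcmod (b k) \<le> star_of C"
proof -
  obtain C where C: "\<And>p k. degree p \<le> n \<Longrightarrow> cmod (coeff p k) \<le> C * N p"
    using coeff_le_poly_norm[OF N] by blast
  define p where "p i = (\<Sum>k\<le>n. monom (star_seq (coeff R k) i) k)" for i
  have deg: "degree (p i) \<le> n" for i unfolding p_def by (rule degree_sum_monom_le)
  have coeff_R: "coeff R k = star_n (\<lambda>i. coeff (p i) k)" for k
  proof (cases "k \<le> n")
    case True
    then show ?thesis by (simp add: p_def coeff_sum_monom star_n_star_seq)
  next
    case False
    then show ?thesis
      using R by (simp add: p_def coeff_sum_monom coeff_eq_0 zero_star.abs_eq star_n.abs_eq)
  qed
  have norm_R: "star_poly_norm N R = star_n (\<lambda>i. N (p i))"
    by (rule star_poly_norm_eq[OF deg coeff_R])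
  \<comment> \<open>Where \<open>N (p i) = 0\<close> the quotient is 0 by convention; the
    coefficient vanishes there too, so the product formula survives.\<close>
  define b :: "nat \<Rightarrow> 'i hypercomplex"
    where "b k = star_n (\<lambda>i. coeff (p i) k / of_real (N (p i)))" for k
  have "coeff R k = b k * hypercomplex_of (star_poly_norm N R)" for k
  proof -
    have "coeff (p i) k = coeff (p i) k / of_real (N (p i)) * of_real (N (p i))" for i
      using C[OF deg[of i], of k] by (cases "N (p i) = 0") auto
    then show ?thesis
      unfolding norm_R b_def hypercomplex_of_def star_map_star_n star_n_arith coeff_R by simp
  qed
  moreover have "hcmod (b k) \<le> star_of \<bar>C\<bar>" for k
  proof -
    have "cmod (coeff (p i) k / of_real (N (p i))) \<le> \<bar>C\<bar>" for i
    proof (cases "N (p i) = 0")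
      case False
      then have "N (p i) > 0" using N deg[of i] by (auto simp: is_poly_norm_def less_le)
      moreover have "cmod (coeff (p i) k) \<le> \<bar>C\<bar> * N (p i)"
        using C[OF deg[of i], of k] \<open>N (p i) > 0\<close> by (smt (verit) mult_right_mono)
      ultimately show ?thesis by (simp add: norm_divide divide_le_eq)
    qed simp
    then show ?thesis unfolding b_def hcmod_def by transfer simp
  qed
  ultimately show thesis by (rule that)
qed

lemma linear_poly_times_const:
  "Vector_Spaces.linear smult (*) (\<lambda>p :: 'a::field poly. poly p x * c)"
  by (simp add: Vector_Spaces.linear_iff vector_space_def smult_add_right smult_add_left
      algebra_simps)

theorem theorem8:
  fixes P :: "complex poly" and n :: nat
  assumes "P \<noteq> 0" and "degree P = n"
  shows "\<exists>L :: complex \<Rightarrow> 'i::ultra_index hypercomplex poly \<Rightarrow> 'i hypercomplex.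
    (\<forall>u. poly P u = 0 \<longrightarrow> Vector_Spaces.linear smult (*) (L u)) \<and>
    (\<forall>N Q u \<xi>. is_poly_norm n N \<longrightarrow> is_deformation P Q \<longrightarrow>
       poly P u = 0 \<longrightarrow> poly Q \<xi> = 0 \<longrightarrow> hfinite \<xi> \<longrightarrow> std_part \<xi> = u \<longrightarrow>
       (\<exists>\<epsilon>. infinitesimal \<epsilon> \<and>
          (\<xi> - star_of u) ^ order u P =
            L u (Q - map_poly star_of P) +
            \<epsilon> * hypercomplex_of (star_poly_norm N (Q - map_poly star_of P))))"
proof -
  \<comment> \<open>This covers every \<open>u\<close>: at a non-root the order is 0 and the
    cofactor is \<open>P\<close> itself.\<close>
  have "\<exists>S. P = [:- u, 1:] ^ order u P * S \<and> poly S u \<noteq> 0" for u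
    using order_decomp[OF \<open>P \<noteq> 0\<close>, of u] by (auto simp: poly_eq_0_iff_dvd)
  then obtain S where P_eq: "P = [:- u, 1:] ^ order u P * S u" and S: "poly (S u) u \<noteq> 0" for u
    by metis
  \<comment> \<open>Only \<open>P\<close> enters, through its cofactor \<open>S u\<close>;
    \<open>N\<close>, \<open>Q\<close> and \<open>\<xi>\<close> are fixed later.\<close>
  define L :: "complex \<Rightarrow> 'i hypercomplex poly \<Rightarrow> 'i hypercomplex"
    where "L u R = poly R (star_of u) * (- inverse (star_of (poly (S u) u)))" for u R
  have "\<exists>\<epsilon>. infinitesimal \<epsilon> \<and> (\<xi> - star_of u) ^ order u P =
      L u (Q - map_poly star_of P) + \<epsilon> * hypercomplex_of (star_poly_norm N (Q - map_poly star_of P))"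
    if N: "is_poly_norm n N" and Q: "is_deformation P Q" and root: "poly Q \<xi> = 0"
      and \<xi>: "hfinite \<xi>" "std_part \<xi> = u" for N Q u \<xi>
  proof -
    define R where "R = Q - map_poly star_of P"
    have "degree (map_poly star_of P :: 'i hypercomplex poly) \<le> n"
      using \<open>degree P = n\<close> map_poly_degree_leq by metis
    then have R: "degree R \<le> n"
      using Q \<open>degree P = n\<close> unfolding R_def is_deformation_def by (intro degree_diff_le) auto
    obtain b C where b: "\<And>k. coeff R k = b k * hypercomplex_of (star_poly_norm N R)"
      and C: "\<And>k. hcmod (b k) \<le> star_of C"
      by (rule coeff_star_poly_norm[OF N R]) (rule that)
    have near: "infinitesimal (\<xi> - star_of u)" using infinitesimal_std_part[OF \<xi>(1)] unfolding \<xi>(2) .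
    define s where "s = star_map (poly (S u)) \<xi>"
    \<comment> \<open>\<open>s\<close> is infinitely close to the nonzero standard number
      \<open>poly (S u) u\<close>.\<close>
    have "s \<noteq> 0"
    proof
      assume "s = 0"
      then have "infinitesimal (star_of (- poly (S u) u) :: 'i hypercomplex)"
        using infinitesimal_star_map_isCont[OF _ near, of "poly (S u)"]
        by (simp add: s_def)
      then show False using S[of u] unfolding infinitesimal_star_of_iff by simp
    qed
    \<comment> \<open>The error in the weight of the coefficient of degree \<open>k\<close> when
      \<open>\<xi>\<close> is replaced by \<open>u\<close>; it is infinitesimal by continuity of
      \<open>x ^ k / poly (S u) x\<close> at \<open>u\<close>.\<close>
    define d where "d k = \<xi> ^ k / s - star_of (u ^ k / poly (S u) u)" for k
    have d: "infinitesimal (d k)" for k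
    proof -
      have "isCont (\<lambda>x. x ^ k / poly (S u) x) u" using S by (intro continuous_intros) auto
      from infinitesimal_star_map_isCont[OF this near] show ?thesis
        by (simp add: d_def s_def star_map_hom star_map_power)
    qed
    define \<epsilon> where "\<epsilon> = (\<Sum>k\<le>n. - b k * d k)"
    have "infinitesimal \<epsilon>"
    proof -
      have "hcmod (- b k) \<le> star_of C" for k
        using C[of k] unfolding hcmod_def by transfer simp
      then show ?thesis
        unfolding \<epsilon>_def by (intro infinitesimal_sum infinitesimal_mult_bounded[OF _ d])
    qed
    moreover have "(\<xi> - star_of u) ^ order u P = L u R + \<epsilon> * hypercomplex_of (star_poly_norm N R)"
    proof -
      \<comment> \<open>An equation of functions, so that \<open>star_map\<close> carries the
        factorization over to \<open>\<xi>\<close>.\<close>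
      have "poly P = (\<lambda>x. (x - u) ^ order u P * poly (S u) x)"
        by (subst P_eq[of u]) (simp add: poly_power fun_eq_iff)
      moreover have "star_map (\<lambda>x. (x - u) ^ k) \<xi> = (\<xi> - star_of u) ^ k" for k
        by (induction k) (simp_all add: star_map_const_ident star_map_hom)
      ultimately have "poly (map_poly star_of P) \<xi> = (\<xi> - star_of u) ^ order u P * s"
        by (simp add: poly_map_poly_star_of star_map_hom s_def)
      \<comment> \<open>Since \<open>\<xi>\<close> is a root of \<open>Q\<close>, the value of
        \<open>R\<close> there is minus that of \<open>P\<close>.\<close>
      then have "poly R \<xi> = - ((\<xi> - star_of u) ^ order u P * s)"
        by (simp add: R_def root)
      then have "(\<xi> - star_of u) ^ order u P = - (poly R \<xi> / s)"
        using \<open>s \<noteq> 0\<close> by simp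
      also have "\<dots> = L u R - (poly R \<xi> / s - poly R (star_of u) / star_of (poly (S u) u))"
        by (simp add: L_def divide_inverse)
      also have "poly R \<xi> / s - poly R (star_of u) / star_of (poly (S u) u) =
          (\<Sum>k\<le>n. coeff R k * d k)"
        by (simp add: poly_eq_sum_coeff[OF R] d_def sum_divide_distrib sum_subtractf star_of_power
            right_diff_distrib)
      also have "\<dots> = - \<epsilon> * hypercomplex_of (star_poly_norm N R)"
        by (simp add: \<epsilon>_def b sum_negf sum_distrib_left mult_ac)
      finally show ?thesis by simp
    qed
    ultimately show ?thesis unfolding R_def by blast
  qed
  moreover have "Vector_Spaces.linear smult (*) (L u)" for u
    unfolding L_def by (rule linear_poly_times_const)
  ultimately show ?thesis by blast
qed

end
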